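(* In the absence of an external field, the momentum conserving graph neural ODE (MCGNODE, defined in the context) exactly conserves the linear momentum. That is, if $\hat q=(\hat q_1,\dots,\hat q_n)$ is the trajectory predicted by an MCGNODE for an $n$-particle system on which no external field acts, and $\hat m_{ii}$ is the learned mass of particle $i$, then $$\sum_{i=1}^n \frac{d}{dt}\left(\hat m_{ii}\,\dot{\hat q}_i\right)=0$$ at all times.
   Context: **System and graph.** A system of $n$ particles with Cartesian positions $q_i$ and velocities $\dot q_i$ is represented by an undirected graph $\mathcal G=(\mathcal V,\mathcal E)$. Nodes are particles and edges are the connections or interactions between them (for example, bars of a pendulum or springs). Node $i$ carries a type $t_i$, and each edge carries the feature $w_{ij}=q_i-q_j$. The set of neighbours of $i$ is $\mathcal N_i$. **Forces in MCGNODE.** For each edge, a graph neural network (message passing using the node types and the edge features, followed by a multilayer perceptron applied to the final edge embedding) outputs the internal force $f_{ij}$ on particle $i$ due to its neighbour $j$. Newton's third law is enforced as an inductive bias: $f_{ij}=-f_{ji}$. A separate multilayer perceptron, applied to an embedding of the position and velocity of particle $i$ (which do not take part in message passing), outputs $N_{gi}$, the force on particle $i$ due to external fields such as gravity. The total predicted force on particle $i$ is $\hat N_i=N_{gi}+\sum_{j\in\mathcal N_i}f_{ij}$. **Predicted dynamics.** Let $M$ be the diagonal mass matrix whose entries are the learned masses $\hat m_{ii}$ (trainable parameters), and let $N$ be the vector of the $\hat N_i$. Any constraints of the system are assumed known and are written $A(q)\dot q=0$, with $A(q)\in\mathbb R^{k\times D}$ for $k$ constraints. The predicted acceleration is $$\ddot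 q=M^{-1}\Big(\Pi-C\dot q-N-\Upsilon-A^T(AM^{-1}A^T)^{-1}\big(AM^{-1}(\Pi-C\dot q-N-\Upsilon)+\dot A\dot q\big)\Big),$$ where $\Pi$ denotes external forces, $C$ Coriolis-like terms and $\Upsilon$ drag. Here $C=0$, and unless otherwise specified $\Pi=0$ and $\Upsilon=0$. For an unconstrained system (for example, an $n$-spring system) the terms containing $A$ are absent. The predicted trajectory $\hat q$ is obtained from this acceleration. **Absence of an external field.** No external field acts on the particles and the dynamics is governed by the internal forces (for instance, in an $n$-spring system), so that $\hat N_i=\sum_{j\in\mathcal N_i}f_{ij}$. **Momentum.** The linear momentum of the predicted trajectory is $\sum_{i=1}^n\hat m_{ii}\dot{\hat q}_i$. Exact conservation means that its time derivative is zero.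
   Formalization: For constrained systems it is also assumed that the constraint reactions are internal: the particle blocks of each row of A(q) sum to zero. Otherwise the claim fails, e.g. for a force-free particle on a circle about a fixed pivot. Unconstrained systems need no extra condition. *)

theory Defs
  imports "HOL-Analysis.Analysis" "HOL-Library.Multiset"
begin

section \<open>Multilayer perceptrons\<close>

text \<open>
  A layer consists of weights, a bias and an activation function (the identity for a
  purely affine layer). All hidden layers of a perceptron share the index type \<open>'u\<close>:
  narrower layers are those whose surplus units have zero outgoing weights.
\<close>

type_synonym ('a, 'b) layer = "(real ^ 'a ^ 'b) \<times> (real ^ 'b) \<times> (real \<Rightarrow> real)"

definition layer_fun :: "('a::finite, 'b::finite) layer \<Rightarrow> real ^ 'a \<Rightarrow> real ^ 'b" where
  "layer_fun L x = (case L of (W, b, \<sigma>) \<Rightarrow> (\<chi> u. \<sigma> ((W *v x + b) $ u)))"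

type_synonym ('a, 'u, 'b) mlp = "('a, 'u) layer \<times> ('u, 'u) layer list \<times> ('u, 'b) layer"

definition mlp_fun :: "('a::finite, 'u::finite, 'b::finite) mlp \<Rightarrow> real ^ 'a \<Rightarrow> real ^ 'b" where
  "mlp_fun P x = (case P of (L\<^sub>i, Ls, L\<^sub>o) \<Rightarrow> layer_fun L\<^sub>o (fold layer_fun Ls (layer_fun L\<^sub>i x)))"


section \<open>States\<close>

text \<open>
  Positions, velocities and forces of all particles are stacked into one vector of dimension
  \<open>D = CARD('n) * CARD('d)\<close>, whose entry \<open>(i, c)\<close> is coordinate \<open>c\<close> of particle \<open>i\<close>.
\<close>

type_synonym ('n, 'd) state = "real ^ ('n \<times> 'd)"

definition particle :: "('n::finite, 'd::finite) state \<Rightarrow> 'n \<Rightarrow> real ^ 'd" where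
  "particle x i = (\<chi> c. x $ (i, c))"

definition stack :: "('n::finite \<Rightarrow> real ^ 'd::finite) \<Rightarrow> ('n, 'd) state" where
  "stack y = (\<chi> p. y (fst p) $ snd p)"


section \<open>The network\<close>

text \<open>
  The encoders and the update maps of the message passing are arbitrary functions. A node update
  sees the neighbours only through the multiset of their messages, so every aggregation that does
  not depend on an order of the neighbours (sum, mean, maximum, attention) is covered.
\<close>

record ('n, 'd, 't, 'h, 'e, 'x, 'u) network =
  node_enc :: "'t \<Rightarrow> real ^ 'h"
  edge_enc :: "real ^ 'd \<Rightarrow> real ^ 'e"
  rounds :: nat
  node_upd :: "nat \<Rightarrow> real ^ 'h \<Rightarrow> ((real ^ 'h) \<times> (real ^ 'e)) multiset \<Rightarrow> real ^ 'h"
  edge_upd :: "nat \<Rightarrow> real ^ 'e \<Rightarrow> real ^ 'h \<Rightarrow> real ^ 'h \<Rightarrow> real ^ 'e"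
  force_mlp :: "('e, 'u, 'd) mlp"
  state_enc :: "real ^ 'd \<Rightarrow> real ^ 'd \<Rightarrow> real ^ 'x"
  field_mlp :: "('x, 'u, 'd) mlp"
  learned_mass :: "'n \<Rightarrow> real"

text \<open>
  The undirected graph is a symmetric relation \<open>E\<close>. Each edge carries one embedding for each of
  its two orientations, because the edge feature changes sign with the orientation.
\<close>

definition neighbours :: "('n \<times> 'n) set \<Rightarrow> 'n \<Rightarrow> 'n set" where
  "neighbours E i = {j. (i, j) \<in> E}"

primrec embeddings ::
  "('n::finite, 'd::finite, 't, 'h::finite, 'e::finite, 'x::finite, 'u::finite) network \<Rightarrow>
   ('n \<times> 'n) set \<Rightarrow> ('n \<Rightarrow> 't) \<Rightarrow> ('n \<Rightarrow> 'n \<Rightarrow> real ^ 'd) \<Rightarrow> nat \<Rightarrow>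
   ('n \<Rightarrow> real ^ 'h) \<times> ('n \<Rightarrow> 'n \<Rightarrow> real ^ 'e)" where
  "embeddings net E ty w 0 = (\<lambda>i. node_enc net (ty i), \<lambda>i j. edge_enc net (w i j))"
| "embeddings net E ty w (Suc l) =
    (let (h, e) = embeddings net E ty w l in
      (\<lambda>i. node_upd net l (h i) (image_mset (\<lambda>j. (h j, e i j)) (mset_set (neighbours E i))),
       \<lambda>i j. edge_upd net l (e i j) (h i) (h j)))"

definition internal_force ::
  "('n::finite, 'd::finite, 't, 'h::finite, 'e::finite, 'x::finite, 'u::finite) network \<Rightarrow>
   ('n \<times> 'n) set \<Rightarrow> ('n \<Rightarrow> 't) \<Rightarrow> ('n, 'd) state \<Rightarrow> 'n \<Rightarrow> 'n \<Rightarrow> real ^ 'd" where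
  "internal_force net E ty q i j =
    mlp_fun (force_mlp net)
      (snd (embeddings net E ty (\<lambda>a b. particle q a - particle q b) (rounds net)) i j)"

definition field_force ::
  "('n::finite, 'd::finite, 't, 'h::finite, 'e::finite, 'x::finite, 'u::finite) network \<Rightarrow>
   ('n, 'd) state \<Rightarrow> ('n, 'd) state \<Rightarrow> 'n \<Rightarrow> real ^ 'd" where
  "field_force net q v i = mlp_fun (field_mlp net) (state_enc net (particle q i) (particle v i))"

definition total_force ::
  "('n::finite, 'd::finite, 't, 'h::finite, 'e::finite, 'x::finite, 'u::finite) network \<Rightarrow>
   ('n \<times> 'n) set \<Rightarrow> ('n \<Rightarrow> 't) \<Rightarrow> ('n, 'd) state \<Rightarrow> ('n, 'd) state \<Rightarrow> 'n \<Rightarrow> real ^ 'd" where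
  "total_force net E ty q v i =
    field_force net q v i + (\<Sum>j\<in>neighbours E i. internal_force net E ty q i j)"

text \<open>
  Newton's third law is a property of the model: it holds at every configuration, not only along
  a given trajectory. The learned masses are nonzero so that the mass matrix is invertible.
\<close>

definition mcgnode ::
  "('n::finite, 'd::finite, 't, 'h::finite, 'e::finite, 'x::finite, 'u::finite) network \<Rightarrow>
   ('n \<times> 'n) set \<Rightarrow> ('n \<Rightarrow> 't) \<Rightarrow> bool" where
  "mcgnode net E ty \<longleftrightarrow>
    sym E \<and>
    (\<forall>i. learned_mass net i \<noteq> 0) \<and>
    (\<forall>q i j. (i, j) \<in> E \<longrightarrow> internal_force net E ty q i j = - internal_force net E ty q j i)"


section \<open>Predicted dynamics\<close>

definition mass_matrix ::
  "('n::finite \<Rightarrow> real) \<Rightarrow> real ^ ('n \<times> 'd::finite) ^ ('n \<times> 'd)" where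
  "mass_matrix m = (\<chi> p r. if p = r then m (fst p) else 0)"

text \<open>
  \<open>P\<close> is the external force \<open>\<Pi>\<close>. A constraint has the form \<open>A(q) *v v = 0\<close>. The last argument is \<open>None\<close> for an unconstrained system, and \<open>Some (A, A')\<close> for the constraint
  matrix and its time derivative at the present instant.
\<close>

definition acceleration ::
  "real ^ ('n::finite \<times> 'd::finite) ^ ('n \<times> 'd) \<Rightarrow> ('n, 'd) state \<Rightarrow>
   real ^ ('n \<times> 'd) ^ ('n \<times> 'd) \<Rightarrow> ('n, 'd) state \<Rightarrow> ('n, 'd) state \<Rightarrow> ('n, 'd) state \<Rightarrow>
   ((real ^ ('n \<times> 'd) ^ 'k::finite) \<times> (real ^ ('n \<times> 'd) ^ 'k)) option \<Rightarrow> ('n, 'd) state" where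
  "acceleration M P C N \<Upsilon> v con =
    (let M' = matrix_inv M; F = P - C *v v - N - \<Upsilon> in
     case con of
       None \<Rightarrow> M' *v F
     | Some (A, A') \<Rightarrow>
         M' *v (F - transpose A *v
           (matrix_inv (A ** M' ** transpose A) *v ((A ** M') *v F + A' *v v))))"

text \<open>
  The map \<open>q\<close> is a trajectory, with velocity \<open>v\<close>, predicted on the time interval \<open>I\<close>
  (derivatives are one-sided at endpoints belonging to \<open>I\<close>). The terms
  \<open>P\<close>, \<open>C\<close> and \<open>\<Upsilon>\<close> are zero. The equation \<open>A(q) *v v = 0\<close> is not imposed: the acceleration
  keeps \<open>A(q) *v v\<close> constant, so it holds whenever it holds initially.
\<close>

definition predicted_trajectory ::
  "('n::finite, 'd::finite, 't, 'h::finite, 'e::finite, 'x::finite, 'u::finite) network \<Rightarrow>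
   ('n \<times> 'n) set \<Rightarrow> ('n \<Rightarrow> 't) \<Rightarrow>
   (('n, 'd) state \<Rightarrow> real ^ ('n \<times> 'd) ^ 'k::finite) option \<Rightarrow>
   real set \<Rightarrow> (real \<Rightarrow> ('n, 'd) state) \<Rightarrow> (real \<Rightarrow> ('n, 'd) state) \<Rightarrow> bool" where
  "predicted_trajectory net E ty con I q v \<longleftrightarrow>
    (let M = mass_matrix (learned_mass net);
         N = (\<lambda>s. stack (total_force net E ty (q s) (v s)))
     in
     \<forall>s\<in>I. (q has_vector_derivative v s) (at s within I) \<and>
       (case con of
          None \<Rightarrow> (v has_vector_derivative acceleration M 0 0 (N s) 0 (v s)
                    (None :: ((real ^ ('n \<times> 'd) ^ 'k) \<times> (real ^ ('n \<times> 'd) ^ 'k)) option))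
                    (at s within I)
        | Some A \<Rightarrow>
            invertible (A (q s) ** matrix_inv M ** transpose (A (q s))) \<and>
            (\<exists>A'. ((\<lambda>r. A (q r)) has_vector_derivative A') (at s within I) \<and>
              (v has_vector_derivative acceleration M 0 0 (N s) 0 (v s) (Some (A (q s), A')))
                (at s within I))))"


section \<open>Absence of an external field\<close>

definition no_external_field ::
  "('n::finite, 'd::finite, 't, 'h::finite, 'e::finite, 'x::finite, 'u::finite) network \<Rightarrow>
   real set \<Rightarrow> (real \<Rightarrow> ('n, 'd) state) \<Rightarrow> (real \<Rightarrow> ('n, 'd) state) \<Rightarrow> bool" where
  "no_external_field net I q v \<longleftrightarrow> (\<forall>s\<in>I. \<forall>i. field_force net (q s) (v s) i = 0)"

text \<open>
  The reaction of constraint \<open>a\<close> on particle \<open>i\<close> is a multiple of block \<open>i\<close> of row \<open>a\<close> of \<open>A(q)\<close>.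
  It is internal to the system if these blocks add up to zero, as for a bar of fixed length
  joining two particles, but not for the attachment of a particle to a fixed pivot. A system
  without constraints satisfies the condition trivially.
\<close>

definition internal_constraints ::
  "(('n::finite, 'd::finite) state \<Rightarrow> real ^ ('n \<times> 'd) ^ 'k::finite) option \<Rightarrow> bool" where
  "internal_constraints con \<longleftrightarrow>
    (case con of None \<Rightarrow> True | Some A \<Rightarrow> \<forall>q a. (\<Sum>i\<in>UNIV. particle (A q $ a) i) = 0)"

definition linear_momentum :: "('n::finite \<Rightarrow> real) \<Rightarrow> ('n, 'd::finite) state \<Rightarrow> real ^ 'd" where
  "linear_momentum m v = (\<Sum>i\<in>UNIV. m i *\<^sub>R particle v i)"

end

theory Submission
  imports Defs
begin

text \<open>
  The predicted acceleration has the form \<open>M\<^sup>-\<^sup>1 F\<close>, so the momentum changes at the rate given by the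
  sum of the blocks of \<open>F\<close> over all particles. The internal forces cancel in this sum by Newton's
  third law. The constraint reaction is \<open>A\<^sup>T \<lambda>\<close> for some multiplier \<open>\<lambda>\<close>, so its blocks add up to a
  combination of the block sums of the rows of \<open>A\<close>, which vanish; the value of \<open>\<lambda>\<close> is irrelevant.
\<close>

lemma linear_particle: "linear (\<lambda>x. particle x i)"
  by (rule linearI) (simp_all add: particle_def vec_eq_iff)

lemma linear_sum_particle: "linear (\<lambda>x. \<Sum>i\<in>UNIV. particle x i)"
  by (intro linear_compose_sum ballI linear_particle)

text \<open>Lets a derivative of the stacked velocity pass to the momentum of a single
  particle.\<close>

lemma bounded_linear_scaled_particle: "bounded_linear (\<lambda>x. c *\<^sub>R particle x i)"
  by (intro bounded_linear_const_scaleR linear_particle[THEN linear_conv_bounded_linear[THEN iffD1]])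

lemma particle_stack [simp]: "particle (stack y) i = y i"
  by (simp add: particle_def stack_def vec_eq_iff)

lemma mass_matrix_vector_mult: "(mass_matrix m *v x) $ p = m (fst p) * x $ p"
  by (simp add: mass_matrix_def matrix_vector_mult_def if_distrib[of "\<lambda>a. a * _"] cong: if_cong)

lemma invertible_mass_matrix:
  fixes m :: "'n::finite \<Rightarrow> real"
  assumes "\<And>i. m i \<noteq> 0"
  shows "invertible (mass_matrix m :: real ^ ('n \<times> 'd::finite) ^ ('n \<times> 'd))"
proof -
  \<comment> \<open>General \<open>k\<close> and \<open>l\<close> serve both orders of
    multiplication, with reciprocal masses as the inverse diagonal.\<close>
  have "mass_matrix k ** mass_matrix l = (mat 1 :: real ^ ('n \<times> 'd) ^ ('n \<times> 'd))"
    if "\<And>i. k i * l i = 1" for k l :: "'n \<Rightarrow> real"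
    using that
    by (simp add: matrix_eq vec_eq_iff mass_matrix_vector_mult mult.assoc[symmetric]
        flip: matrix_vector_mul_assoc)
  from this[of m "\<lambda>i. inverse (m i)"] this[of "\<lambda>i. inverse (m i)" m] show ?thesis
    using assms unfolding invertible_def by auto
qed

text \<open>Weighting block \<open>i\<close> by \<open>m i\<close> is the action of the mass matrix
  on that block, so it undoes the inverse and leaves the bare forces.\<close>

lemma linear_momentum_matrix_inv_mass_matrix:
  fixes m :: "'n::finite \<Rightarrow> real" and F :: "('n, 'd::finite) state"
  assumes "\<And>i. m i \<noteq> 0"
  shows "linear_momentum m (matrix_inv (mass_matrix m) *v F) = (\<Sum>i\<in>UNIV. particle F i)"
proof -
  let ?M = "mass_matrix m :: real ^ ('n \<times> 'd) ^ ('n \<times> 'd)"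
  have "invertible ?M"
    using assms by (rule invertible_mass_matrix)
  then have "?M ** matrix_inv ?M = mat 1"
    unfolding invertible_def matrix_inv_def by (rule someI2_ex) simp
  then have "?M *v (matrix_inv ?M *v F) = F"
    by (simp add: matrix_vector_mul_assoc)
  then have "m i * (matrix_inv ?M *v F) $ (i, c) = F $ (i, c)" for i c
    by (metis fst_conv mass_matrix_vector_mult)
  then have "m i *\<^sub>R particle (matrix_inv ?M *v F) i = particle F i" for i
    by (simp add: particle_def vec_eq_iff)
  then show ?thesis
    by (simp add: linear_momentum_def)
qed

lemma sum_particle_constraint_reaction:
  fixes A :: "real ^ ('n::finite \<times> 'd::finite) ^ 'k::finite"
  assumes "\<And>a. (\<Sum>i\<in>UNIV. particle (A $ a) i) = 0"
  shows "(\<Sum>i\<in>UNIV. particle (transpose A *v l) i) = 0"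
proof -
  \<comment> \<open>The reaction is a combination of the rows of \<open>A\<close>, so linearity
    reduces the claim to single rows.\<close>
  have "transpose A *v l = (\<Sum>a\<in>UNIV. l $ a *\<^sub>R A $ a)"
    by (simp add: matrix_mult_sum column_transpose row_def scalar_mult_eq_scaleR)
  then show ?thesis
    by (simp add: linear_sum[OF linear_sum_particle] linear_scale[OF linear_sum_particle] assms)
qed

lemma sum_antisymmetric_eq_0:
  fixes f :: "'n::finite \<Rightarrow> 'n \<Rightarrow> 'v::real_vector"
  assumes "sym E" and "\<And>i j. (i, j) \<in> E \<Longrightarrow> f i j = - f j i"
  shows "(\<Sum>i\<in>UNIV. \<Sum>j\<in>neighbours E i. f i j) = 0"
proof -
  \<comment> \<open>Extension by zero off \<open>E\<close> makes the inner range independent of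
    \<open>i\<close>, so the sums can be swapped; symmetry of \<open>E\<close> keeps
    \<open>g\<close> antisymmetric.\<close>
  define g where "g i j = (if (i, j) \<in> E then f i j else 0)" for i j
  have "(\<Sum>i\<in>UNIV. \<Sum>j\<in>neighbours E i. f i j) = (\<Sum>i\<in>UNIV. \<Sum>j\<in>UNIV. g i j)"
    unfolding g_def neighbours_def by (simp add: sum.If_cases)
  moreover have "(\<Sum>i\<in>UNIV. \<Sum>j\<in>UNIV. g i j) = - (\<Sum>i\<in>UNIV. \<Sum>j\<in>UNIV. g i j)"
  proof -
    have "g i j = - g j i" for i j
    proof (cases "(i, j) \<in> E")
      case True
      then show ?thesis
        using assms(2)[OF True] symD[OF assms(1) True] by (simp add: g_def)
    next
      case False
      then have "(j, i) \<notin> E"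
        using symD[OF assms(1)] by blast
      with False show ?thesis
        by (simp add: g_def)
    qed
    then have "(\<Sum>i\<in>UNIV. \<Sum>j\<in>UNIV. g i j) = (\<Sum>i\<in>UNIV. \<Sum>j\<in>UNIV. - g j i)"
      by (intro sum.cong refl)
    also have "\<dots> = - (\<Sum>j\<in>UNIV. \<Sum>i\<in>UNIV. g j i)"
      by (subst sum.swap) (simp add: sum_negf)
    finally show ?thesis .
  qed
  ultimately show ?thesis
    \<comment> \<open>A real vector equal to its own negative is zero.\<close>
    by (metis eq_neg_iff_add_eq_0 scaleR_2 scaleR_eq_0_iff zero_neq_numeral)
qed

lemma sum_total_force_eq_0:
  assumes "mcgnode net E ty" and "\<And>i. field_force net q v i = 0"
  shows "(\<Sum>i\<in>UNIV. total_force net E ty q v i) = 0"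
  using assms unfolding mcgnode_def total_force_def by (simp add: sum_antisymmetric_eq_0)

lemma linear_momentum_acceleration_eq_0:
  assumes "\<And>i. m i \<noteq> 0" and "(\<Sum>i\<in>UNIV. particle N i) = 0"
    and "\<And>A A' a. con = Some (A, A') \<Longrightarrow> (\<Sum>i\<in>UNIV. particle (A $ a) i) = 0"
  shows "linear_momentum m (acceleration (mass_matrix m) 0 0 N 0 v con) = 0"
  by (cases con)
    \<comment> \<open>The deleted simp rule would turn \<open>transpose A *v l\<close> into
      \<open>l v* A\<close>, and the reaction lemma would no longer match.\<close>
    (auto simp: acceleration_def Let_def linear_momentum_matrix_inv_mass_matrix assms
      linear_diff[OF linear_sum_particle] linear_neg[OF linear_sum_particle]
      sum_particle_constraint_reaction simp del: transpose_matrix_vector)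

text \<open>A connected set with more than one point has no isolated point. Derivatives within
  \<open>I\<close> are therefore unique, which gives \<open>vector_derivative\<close> a definite
  value.\<close>

lemma at_within_interval_neq_bot:
  fixes I :: "real set"
  assumes "is_interval I" and "interior I \<noteq> {}" and "t \<in> I"
  shows "at t within I \<noteq> bot"
proof -
  have "I \<noteq> {t}"
    using assms(2) by auto
  then have "t islimpt I"
    using assms by (intro connected_imp_perfect) (auto simp: is_interval_connected)
  then show ?thesis
    by (simp add: trivial_limit_within)
qed

theorem theorem1:
  fixes net :: "('n::finite, 'd::finite, 't, 'h::finite, 'e::finite, 'x::finite, 'u::finite) network"
    and E :: "('n \<times> 'n) set"
    and ty :: "'n \<Rightarrow> 't"
    and con :: "(('n, 'd) state \<Rightarrow> real ^ ('n \<times> 'd) ^ 'k::finite) option"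
    and I :: "real set"
    and q v :: "real \<Rightarrow> ('n, 'd) state"
  assumes "mcgnode net E ty"
    and "is_interval I" and "interior I \<noteq> {}"
    and "predicted_trajectory net E ty con I q v"
    and "no_external_field net I q v"
    and "internal_constraints con"
  shows "\<forall>t\<in>I.
    (\<Sum>i\<in>UNIV. vector_derivative (\<lambda>s. learned_mass net i *\<^sub>R particle (v s) i) (at t within I)) = 0 \<and>
    ((\<lambda>s. linear_momentum (learned_mass net) (v s)) has_vector_derivative 0) (at t within I)"
proof
  fix t assume "t \<in> I"
  let ?m = "learned_mass net"
  let ?N = "stack (total_force net E ty (q t) (v t))"
  have m: "?m i \<noteq> 0" for i
    using assms(1) by (simp add: mcgnode_def)
  have N: "(\<Sum>i\<in>UNIV. particle ?N i) = 0"
    using assms(5) \<open>t \<in> I\<close> sum_total_force_eq_0[OF assms(1)]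
    by (simp add: no_external_field_def)
  \<comment> \<open>\<open>c\<close> is the constraint data at time \<open>t\<close>:
    \<open>None\<close>, or \<open>A (q t)\<close> paired with its time derivative. Both cases then
    share one formula.\<close>
  obtain c :: "((real ^ ('n \<times> 'd) ^ 'k) \<times> (real ^ ('n \<times> 'd) ^ 'k)) option"
    where v: "(v has_vector_derivative acceleration (mass_matrix ?m) 0 0 ?N 0 (v t) c) (at t within I)"
    and c: "\<And>A A' a. c = Some (A, A') \<Longrightarrow> (\<Sum>i\<in>UNIV. particle (A $ a) i) = 0"
    using assms(4,6) \<open>t \<in> I\<close>
    by (fastforce simp: predicted_trajectory_def internal_constraints_def Let_def split: option.splits)
  define a where "a = acceleration (mass_matrix ?m) 0 0 ?N 0 (v t) c"
  have "((\<lambda>s. ?m i *\<^sub>R particle (v s) i) has_vector_derivative ?m i *\<^sub>R particle a i) (at t within I)" for i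
    using v unfolding a_def
    by (rule bounded_linear.has_vector_derivative[OF bounded_linear_scaled_particle])
  note deriv = this
  have sum: "(\<Sum>i\<in>UNIV. ?m i *\<^sub>R particle a i) = 0"
    using linear_momentum_acceleration_eq_0[OF m N c] by (simp add: a_def linear_momentum_def)
  have "vector_derivative (\<lambda>s. ?m i *\<^sub>R particle (v s) i) (at t within I) = ?m i *\<^sub>R particle a i" for i
    using at_within_interval_neq_bot[OF assms(2,3) \<open>t \<in> I\<close>] deriv by (rule vector_derivative_within)
  moreover have "((\<lambda>s. linear_momentum ?m (v s)) has_vector_derivative 0) (at t within I)"
    \<comment> \<open>Zero is written as the sum of the individual derivatives, so that the sum rule
      applies.\<close>
    unfolding linear_momentum_def sum[symmetric] by (intro has_vector_derivative_sum deriv)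
  ultimately show "(\<Sum>i\<in>UNIV. vector_derivative (\<lambda>s. ?m i *\<^sub>R particle (v s) i) (at t within I)) = 0 \<and>
    ((\<lambda>s. linear_momentum ?m (v s)) has_vector_derivative 0) (at t within I)"
    by (simp add: sum)
qed

end
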